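(* Let $K$ be a commutative $\mathbb Q$-algebra, $n\ge1$, and let $F=X-H$ be a polynomial map over $K$ in $n$ variables having symmetric Jacobian matrix, with $H=(H_1,\ldots,H_n)$ homogeneous of degree $2$ and $(JH)^4=0$. Then $F$ is invertible with $$F^{-1}=X+N^{(1)}+N^{(2)}+N^{(3)}+N^{(4)}.$$ In particular, the degree of $F^{-1}$ is $\le 5$.
   Context: $X=(X_1,\ldots,X_n)$, and $JH=(D_iH_j)$ with $D_i=\partial/\partial X_i$. "Homogeneous of degree $2$" means each $H_i\in K[X_1,\ldots,X_n]$ is homogeneous of degree $2$ (possibly zero). "Invertible" means that $F$ has an inverse under composition which is a polynomial map over $K$. Such an $F=X-H$ always has a unique formal inverse $G$ (a system of power series $G_i=X_i+\text{higher degree terms}$ with $F\circ G=G\circ F=X$), and when $H$ is homogeneous of degree $d=2$ it has the form $G=X+N^{(1)}+N^{(2)}+N^{(3)}+\cdots$ with $N^{(m)}$ (an $n$-tuple) homogeneous of degree $m(d-1)+1=m+1$; this defines the $N^{(m)}$. *)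

theory Defs
  imports
    "HOL-Analysis.Finite_Cartesian_Product"
    "HOL-Library.Poly_Mapping"
begin

section \<open>Polynomials and polynomial maps\<close>

text \<open>
  The variables are indexed by a finite type \<open>'n\<close>, so that \<open>n = CARD('n) \<ge> 1\<close>. A monomial is
  its exponent vector; multiplication of polynomials is the convolution product of
  \<^theory>\<open>HOL-Library.Poly_Mapping\<close>.
\<close>

type_synonym 'n monom = "'n \<Rightarrow>\<^sub>0 nat"
type_synonym ('n, 'a) mpoly = "'n monom \<Rightarrow>\<^sub>0 'a"
type_synonym ('n, 'a) poly_map = "('n, 'a) mpoly ^ 'n"

definition mdeg :: "('n::finite) monom \<Rightarrow> nat" where
  "mdeg e = (\<Sum>i\<in>UNIV. Poly_Mapping.lookup e i)"

definition Const :: "'a \<Rightarrow> ('n::finite, 'a::comm_ring_1) mpoly" where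
  "Const c = Poly_Mapping.single 0 c"

definition Var :: "'n \<Rightarrow> ('n::finite, 'a::comm_ring_1) mpoly" where
  "Var i = Poly_Mapping.single (Poly_Mapping.single i 1) 1"

definition Xmap :: "('n::finite, 'a::comm_ring_1) poly_map" where
  "Xmap = (\<chi> i. Var i)"

definition homogeneous :: "nat \<Rightarrow> ('n::finite, 'a::comm_ring_1) mpoly \<Rightarrow> bool" where
  "homogeneous d p \<longleftrightarrow> (\<forall>e\<in>Poly_Mapping.keys p. mdeg e = d)"

text \<open>The zero polynomial gets degree \<open>0\<close>.\<close>

definition total_degree :: "('n::finite, 'a::comm_ring_1) mpoly \<Rightarrow> nat" where
  "total_degree p = Max (insert 0 (mdeg ` Poly_Mapping.keys p))"

definition map_degree :: "('n::finite, 'a::comm_ring_1) poly_map \<Rightarrow> nat" where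
  "map_degree F = Max (range (\<lambda>i. total_degree (F $ i)))"

text \<open>Where \<open>lookup e i = 0\<close>, the coefficient vanishes and the truncated exponent is irrelevant.\<close>

definition partial_deriv ::
    "'n \<Rightarrow> ('n::finite, 'a::comm_ring_1) mpoly \<Rightarrow> ('n, 'a) mpoly" where
  "partial_deriv i p = (\<Sum>e\<in>Poly_Mapping.keys p.
     Poly_Mapping.single (e - Poly_Mapping.single i 1)
       (of_nat (Poly_Mapping.lookup e i) * Poly_Mapping.lookup p e))"

definition jacobian :: "('n::finite, 'a::comm_ring_1) poly_map \<Rightarrow> ('n, 'a) mpoly ^ 'n ^ 'n" where
  "jacobian F = (\<chi> i j. partial_deriv i (F $ j))"

definition mpoly_subst ::
    "('n::finite, 'a::comm_ring_1) mpoly \<Rightarrow> ('n, 'a) poly_map \<Rightarrow> ('n, 'a) mpoly" where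
  "mpoly_subst p G = (\<Sum>e\<in>Poly_Mapping.keys p.
     Const (Poly_Mapping.lookup p e) * (\<Prod>i\<in>UNIV. (G $ i) ^ Poly_Mapping.lookup e i))"

definition poly_map_comp ::
    "('n::finite, 'a::comm_ring_1) poly_map \<Rightarrow> ('n, 'a) poly_map \<Rightarrow> ('n, 'a) poly_map" where
  "poly_map_comp F G = (\<chi> i. mpoly_subst (F $ i) G)"

definition is_poly_inverse ::
    "('n::finite, 'a::comm_ring_1) poly_map \<Rightarrow> ('n, 'a) poly_map \<Rightarrow> bool" where
  "is_poly_inverse F G \<longleftrightarrow> poly_map_comp F G = Xmap \<and> poly_map_comp G F = Xmap"

definition map_invertible :: "('n::finite, 'a::comm_ring_1) poly_map \<Rightarrow> bool" where
  "map_invertible F \<longleftrightarrow> (\<exists>G. is_poly_inverse F G)"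

definition map_inverse :: "('n::finite, 'a::comm_ring_1) poly_map \<Rightarrow> ('n, 'a) poly_map" where
  "map_inverse F = (THE G. is_poly_inverse F G)"


section \<open>Formal power series in several variables\<close>

typedef ('n, 'a) mps = "UNIV :: ('n monom \<Rightarrow> 'a) set"
  morphisms coeff Abs_mps ..

lemma mps_eqI: "(\<And>e. coeff f e = coeff g e) \<Longrightarrow> f = g"
  by (simp add: coeff_inject[symmetric] fun_eq_iff)

lemma coeff_Abs_mps [simp]: "coeff (Abs_mps f) = f"
  by (simp add: Abs_mps_inverse)

lemma finite_bounded_monoms: "finite {e :: ('n::finite) monom. \<forall>i. Poly_Mapping.lookup e i \<le> b i}"
proof -
  have "Poly_Mapping.lookup ` {e :: 'n monom. \<forall>i. Poly_Mapping.lookup e i \<le> b i} \<subseteq> (\<Pi>\<^sub>E i\<in>UNIV. {..b i})"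
    by (auto simp: PiE_def)
  moreover have "finite (\<Pi>\<^sub>E i\<in>(UNIV::'n set). {..b i})"
    by (intro finite_PiE) auto
  ultimately have "finite (Poly_Mapping.lookup ` {e :: 'n monom. \<forall>i. Poly_Mapping.lookup e i \<le> b i})"
    by (rule finite_subset)
  then show ?thesis
    by (rule finite_imageD) (auto intro: inj_onI poly_mapping_eqI)
qed

lemma lookup_le_mdeg: "Poly_Mapping.lookup e i \<le> mdeg (e :: ('n::finite) monom)"
  unfolding mdeg_def by (rule member_le_sum) auto

lemma finite_mdeg_le [simp]: "finite {e :: ('n::finite) monom. mdeg e \<le> d}"
  by (rule finite_subset[OF _ finite_bounded_monoms[of "\<lambda>_. d"]])
    (auto intro: order_trans[OF lookup_le_mdeg])

lemma finite_mdeg_eq [simp]: "finite {e :: ('n::finite) monom. mdeg e = d}"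
  by (rule finite_subset[OF _ finite_mdeg_le[of d]]) auto

definition antidiag :: "('n::finite) monom \<Rightarrow> ('n monom \<times> 'n monom) set" where
  "antidiag e = {(a, b). a + b = e}"

lemma finite_antidiag [simp]: "finite (antidiag e)"
proof (rule finite_subset)
  let ?B = "{a. \<forall>i. Poly_Mapping.lookup a i \<le> Poly_Mapping.lookup e i}"
  show "antidiag e \<subseteq> ?B \<times> ?B"
    by (auto simp: antidiag_def lookup_add)
  show "finite (?B \<times> ?B)"
    by (intro finite_cartesian_product finite_bounded_monoms)
qed

instantiation mps :: (finite, comm_ring_1) comm_ring_1
begin

definition "0 = Abs_mps (\<lambda>_. 0)"
definition "1 = Abs_mps (\<lambda>e. if e = 0 then 1 else 0)"
definition "f + g = Abs_mps (\<lambda>e. coeff f e + coeff g e)"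
definition "f - g = Abs_mps (\<lambda>e. coeff f e - coeff g e)"
definition "- f = Abs_mps (\<lambda>e. - coeff f e)"
definition "f * g = Abs_mps (\<lambda>e. \<Sum>(a, b)\<in>antidiag e. coeff f a * coeff g b)"

instance
proof
  fix f g h :: "('a, 'b) mps"
  show "f * g * h = f * (g * h)"
  proof (rule mps_eqI)
    fix e
    have "coeff (f * g * h) e =
        (\<Sum>(p, c)\<in>antidiag e. \<Sum>(a, b)\<in>antidiag p. coeff f a * coeff g b * coeff h c)"
      by (simp add: times_mps_def sum_distrib_right case_prod_unfold)
    also have "\<dots> = (\<Sum>((p, c), (a, b))\<in>Sigma (antidiag e) (\<lambda>(p, c). antidiag p).
        coeff f a * coeff g b * coeff h c)"
      by (subst sum.Sigma[symmetric]) (auto simp: case_prod_unfold)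
    also have "\<dots> = (\<Sum>((a, q), (b, c))\<in>Sigma (antidiag e) (\<lambda>(a, q). antidiag q).
        coeff f a * (coeff g b * coeff h c))"
      by (rule sum.reindex_bij_witness[
            where i = "\<lambda>((a, q), (b, c)). ((a + b, c), (a, b))"
              and j = "\<lambda>((p, c), (a, b)). ((a, b + c), (b, c))"])
        (auto simp: antidiag_def add.assoc mult.assoc)
    also have "\<dots> =
        (\<Sum>(a, q)\<in>antidiag e. \<Sum>(b, c)\<in>antidiag q. coeff f a * (coeff g b * coeff h c))"
      by (subst sum.Sigma[symmetric]) (auto simp: case_prod_unfold)
    also have "\<dots> = coeff (f * (g * h)) e"
      by (simp add: times_mps_def sum_distrib_left case_prod_unfold)
    finally show "coeff (f * g * h) e = coeff (f * (g * h)) e" .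
  qed
  show "f * g = g * f"
  proof (rule mps_eqI)
    fix e
    show "coeff (f * g) e = coeff (g * f) e"
      unfolding times_mps_def coeff_Abs_mps
      by (rule sum.reindex_bij_witness[where i = "\<lambda>(a, b). (b, a)" and j = "\<lambda>(a, b). (b, a)"])
        (auto simp: antidiag_def add.commute mult.commute)
  qed
  show "1 * f = f"
  proof (rule mps_eqI)
    fix e
    have "coeff (1 * f) e =
        (\<Sum>(a, b)\<in>antidiag e. (if a = 0 then 1 else 0) * coeff f b)"
      by (simp add: times_mps_def one_mps_def)
    also have "\<dots> = (\<Sum>(a, b)\<in>{(0 :: 'a monom, e)}. (if a = 0 then 1 else 0) * coeff f b)"
      by (rule sum.mono_neutral_right[OF finite_antidiag])
        (auto simp: antidiag_def split: if_splits)
    finally show "coeff (1 * f) e = coeff f e" by simp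
  qed
  show "(f + g) * h = f * h + g * h"
    by (rule mps_eqI)
      (simp add: times_mps_def plus_mps_def distrib_right sum.distrib case_prod_unfold)
  show "(0 :: ('a, 'b) mps) \<noteq> 1"
  proof
    assume "(0 :: ('a, 'b) mps) = 1"
    then have "coeff (0 :: ('a, 'b) mps) 0 = coeff 1 0" by simp
    then show False by (simp add: zero_mps_def one_mps_def)
  qed
qed (auto intro!: mps_eqI simp: zero_mps_def plus_mps_def minus_mps_def uminus_mps_def)

end

definition mps_of_mpoly :: "('n::finite, 'a::comm_ring_1) mpoly \<Rightarrow> ('n, 'a) mps" where
  "mps_of_mpoly p = Abs_mps (Poly_Mapping.lookup p)"

text \<open>
  Substitution of a tuple \<open>G\<close> of power series without constant term into a power series:
  \<open>f(G) = (\<Sum>k. coeff f k * G^k)\<close>. As \<open>G^k\<close> has order at least \<open>mdeg k\<close>, only the exponents \<open>k\<close>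
  with \<open>mdeg k \<le> mdeg e\<close> contribute to the coefficient at \<open>e\<close>. The definition is meaningful
  only if no \<open>G $ i\<close> has a constant term.
\<close>

definition mps_subst ::
    "('n::finite, 'a::comm_ring_1) mps \<Rightarrow> ('n, 'a) mps ^ 'n \<Rightarrow> ('n, 'a) mps" where
  "mps_subst f G = Abs_mps (\<lambda>e. \<Sum>k | mdeg k \<le> mdeg e.
     coeff f k * coeff (\<Prod>i\<in>UNIV. (G $ i) ^ Poly_Mapping.lookup k i) e)"

definition mps_map_comp ::
    "('n::finite, 'a::comm_ring_1) mps ^ 'n \<Rightarrow> ('n, 'a) mps ^ 'n \<Rightarrow> ('n, 'a) mps ^ 'n" where
  "mps_map_comp F G = (\<chi> i. mps_subst (F $ i) G)"

definition formal_map :: "('n::finite, 'a::comm_ring_1) poly_map \<Rightarrow> ('n, 'a) mps ^ 'n" where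
  "formal_map F = (\<chi> i. mps_of_mpoly (F $ i))"


section \<open>The formal inverse and its homogeneous components\<close>

text \<open>The first conjunct says \<open>G $ i = X\<^sub>i +\<close> terms of degree at least \<open>2\<close>.\<close>

definition is_formal_inverse ::
    "('n::finite, 'a::comm_ring_1) poly_map \<Rightarrow> ('n, 'a) mps ^ 'n \<Rightarrow> bool" where
  "is_formal_inverse F G \<longleftrightarrow>
     (\<forall>i e. mdeg e \<le> 1 \<longrightarrow> coeff (G $ i) e = Poly_Mapping.lookup (Var i) e) \<and>
     mps_map_comp (formal_map F) G = formal_map Xmap \<and>
     mps_map_comp G (formal_map F) = formal_map Xmap"

definition formal_inverse :: "('n::finite, 'a::comm_ring_1) poly_map \<Rightarrow> ('n, 'a) mps ^ 'n" where
  "formal_inverse F = (THE G. is_formal_inverse F G)"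

definition hom_component :: "nat \<Rightarrow> ('n::finite, 'a::comm_ring_1) mps \<Rightarrow> ('n, 'a) mpoly" where
  "hom_component d f = (\<Sum>e | mdeg e = d. Poly_Mapping.single e (coeff f e))"

text \<open>
  \<open>N^(m)\<close> for \<open>F = X - H\<close> with \<open>H\<close> homogeneous of degree \<open>2\<close>: the component of the formal inverse
  of degree \<open>m (2 - 1) + 1 = m + 1\<close>.
\<close>

definition inverse_part :: "('n::finite, 'a::comm_ring_1) poly_map \<Rightarrow> nat \<Rightarrow> ('n, 'a) poly_map" where
  "inverse_part F m = (\<chi> i. hom_component (m + 1) (formal_inverse F $ i))"


section \<open>Commutative algebras over the rationals\<close>

definition rat_algebra :: "(rat \<Rightarrow> 'a \<Rightarrow> 'a::comm_ring_1) \<Rightarrow> bool" where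
  "rat_algebra qscale \<longleftrightarrow>
     vector_space qscale \<and> (\<forall>q x y. qscale q (x * y) = qscale q x * y)"

end

theory Submission
  imports Defs
begin

text \<open>
  Write \<open>u v\<close> for the bilinear product on polynomial vectors that polarizes \<open>2 H\<close>, so that
  \<open>X X = 2 H\<close> and \<open>X v = (JH) v\<close>. Symmetry of \<open>JH\<close> makes \<open>\<langle>u v, w\<rangle>\<close> totally symmetric, so besides
  \<open>X (X (X (X v))) = 0\<close> the derivative of \<open>\<langle>u, (JH)\<^sup>4 v\<rangle> = 0\<close> yields
  \<open>\<Sum>i\<le>3. ((JH)\<^sup>i u) ((JH)\<^bsup>3-i\<^esup> v) = 0\<close>. Applying the derivation \<open>\<Sum>j. H\<^sub>j D\<^sub>j\<close> repeatedly to a few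
  instances of these two identities makes the components of degree at least 6 vanish in the recursion
  \<open>2 (G - X) = G G\<close> for the inverse. Finally \<open>F\<close> is injective on the points of every commutative \<open>K\<close>-algebra,
  because \<open>F(A) = F(B)\<close> makes \<open>A - B\<close> a fixed vector of the nilpotent matrix
  \<open>JH((A + B)/2)\<close>; applied to points in polynomials and in power series this gives that \<open>G\<close> is a
  two-sided inverse and is unique in both settings.
\<close>

section \<open>The identities in the polarized algebra\<close>

text \<open>An abstract copy of the situation: the product is the polarization of
  \<open>2 H\<close>, \<open>x\<close> and \<open>y\<close> are the vectors \<open>X\<close> and
  \<open>H\<close>, and \<open>D\<close> is the derivation along \<open>H\<close>. \<open>L4\<close>
  records nilpotency and \<open>form4\<close> its derivative. Only torsion-freeness is assumed, so a
  relation is halved by showing that its double vanishes.\<close>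

locale quadratic_flow =
  fixes mult :: "'v::ab_group_add \<Rightarrow> 'v \<Rightarrow> 'v"  (infixl "\<odot>" 70)
    and D :: "'v \<Rightarrow> 'v" and x y :: 'v
  assumes two_torsion_free: "v + v = 0 \<Longrightarrow> v = 0"
    and mult_commute: "u \<odot> v = v \<odot> u"
    and mult_add_left: "(u + v) \<odot> w = u \<odot> w + v \<odot> w"
    and D_add: "D (u + v) = D u + D v"
    and D_mult: "D (u \<odot> v) = D u \<odot> v + u \<odot> D v"
    and D_x: "D x = y"
    and x_x: "x \<odot> x = y + y"
    and L4: "x \<odot> (x \<odot> (x \<odot> (x \<odot> v))) = 0"
    and form4: "u \<odot> (x \<odot> (x \<odot> (x \<odot> v))) + (x \<odot> u) \<odot> (x \<odot> (x \<odot> v))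
      + (x \<odot> (x \<odot> u)) \<odot> (x \<odot> v) + (x \<odot> (x \<odot> (x \<odot> u))) \<odot> v = 0"
begin

lemma mult_add_right: "w \<odot> (u + v) = w \<odot> u + w \<odot> v"
  using mult_add_left[of u v w] by (simp add: mult_commute)

lemma mult_zero: "0 \<odot> w = 0" "w \<odot> 0 = 0"
  using mult_add_left[of 0 0 w] mult_add_right[of w 0 0] by simp_all

lemma mult_minus: "(- u) \<odot> w = - (u \<odot> w)" "w \<odot> (- u) = - (w \<odot> u)"
  using mult_add_left[of u "- u" w] mult_add_right[of w u "- u"]
  by (simp_all add: mult_zero minus_unique)

lemma D_zero: "D 0 = 0"
  using D_add[of 0 0] by simp

lemma D_minus: "D (- u) = - D u"
  using D_add[of u "- u"] by (simp add: D_zero minus_unique)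

lemma four_torsion_free: "(v::'v) + v + v + v = 0 \<Longrightarrow> v = 0"
  using two_torsion_free[of v] two_torsion_free[of "v + v"] by (simp add: add.assoc)

lemmas bilinear = mult_add_left mult_add_right mult_zero mult_minus

text \<open>
  Giving \<open>x\<close> weight 0 and letting each product add 1, the equation splits by weight. Weights up to 4
  define \<open>G\<close>; weights 5 to 9 have to vanish. In \<open>d'\<close>, the prime means half.
\<close>

theorem inverse_terminates:
  assumes half: "d' + d' = y \<odot> y"
  defines "G \<equiv> x + y + x \<odot> y + (x \<odot> (x \<odot> y) + d') + x \<odot> d'"
  shows "(G - x) + (G - x) = G \<odot> G"
proof -
  define b where "b = x \<odot> y"
  define c where "c = x \<odot> b"
  define d where "d = y \<odot> y"
  define e where "e = x \<odot> d"
  define q where "q = y \<odot> c"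
  \<comment> \<open>At \<open>v = x\<close>, with \<open>x \<odot> x = y + y\<close>, nilpotency
    reads \<open>2 (x \<odot> c) = 0\<close>.\<close>
  have xc: "x \<odot> c = 0"
    using L4[of x] two_torsion_free[of "x \<odot> c"] by (simp add: x_x bilinear b_def c_def)
  have yb: "y \<odot> b = 0"
    \<comment> \<open>The two outer terms contain \<open>x \<odot> c\<close>; the two inner ones add
      up to \<open>8 (y \<odot> b)\<close>.\<close>
    using form4[of x x] xc
    by (intro two_torsion_free[OF four_torsion_free[of "y \<odot> b + y \<odot> b"]])
      (simp add: x_x bilinear b_def[symmetric] c_def[symmetric] mult_commute[of b y] mult_commute[of c x] ac_simps)
  have xb: "x \<odot> b = c" and xy: "x \<odot> y = b" and yy: "y \<odot> y = d" and xd: "x \<odot> d = e"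
    and yc: "y \<odot> c = q"
    by (simp_all add: b_def c_def d_def e_def q_def)
  have Dy: "D y = b"
  proof -
    have "D y + D y = b + b"
      using D_mult[of x x] by (simp add: x_x D_add D_x xy mult_commute[of y x])
    moreover have "(D y - b) + (D y - b) = (D y + D y) - (b + b)"
      by simp
    ultimately have "(D y - b) + (D y - b) = 0"
      by simp
    then show ?thesis
      using two_torsion_free[of "D y - b"] by simp
  qed
  have Db: "D b = c + d"
    using D_mult[of x y] by (simp add: xy xb yy D_x Dy add.commute)
  have Dc: "D c = e"
    using D_mult[of x b] by (simp add: xb D_x Db yb xc xd bilinear)
  have Dd: "D d = 0"
    using yb by (simp add: d_def D_mult Dy bilinear mult_commute[of b y])
  \<comment> \<open>From here on, applying \<open>D\<close> to a known relation gives a relation one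
    weight higher.\<close>
  have xe: "x \<odot> e = - q"
    using D_mult[of x c] by (simp add: xc yc D_zero D_x Dc eq_neg_iff_add_eq_0 add.commute)
  \<comment> \<open>At \<open>u = x\<close>, \<open>v = y\<close> the form identity becomes
    \<open>2 (b \<odot> b + 2 q) = 0\<close>.\<close>
  have bb: "b \<odot> b = - (q + q)"
  proof -
    have "(b \<odot> b + (q + q)) + (b \<odot> b + (q + q)) = 0"
      using form4[of x y] by (simp add: xy xb xc x_x bilinear yc mult_commute[of c y] ac_simps)
    then show ?thesis
      unfolding eq_neg_iff_add_eq_0 by (rule two_torsion_free)
  qed
  have yd: "y \<odot> d = q"
    using D_mult[of y b] by (simp add: yb D_zero Dy Db bilinear bb yc)
  have De: "D e = q"
    by (simp add: e_def D_mult D_x Dd bilinear yd)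
  have bc: "b \<odot> c = 0"
    using form4[of y y] two_torsion_free[of "b \<odot> c"]
    by (simp add: xy xb xc bilinear mult_commute[of c b])
  have Dq: "D q = y \<odot> e"
    by (simp add: q_def D_mult Dy Dc bc)
  have bd: "b \<odot> d = y \<odot> e"
    using D_mult[of y d] by (simp add: yd Dq Dy Dd mult_zero)
  \<comment> \<open>\<open>D\<close> applied to \<open>b \<odot> b + 2 q = 0\<close> gives
    \<open>2 (b \<odot> c) + 2 (b \<odot> d) + 2 (y \<odot> e) = 0\<close>. The first term vanishes
    and \<open>b \<odot> d = y \<odot> e\<close>, so four copies of \<open>y \<odot> e\<close>
    remain.\<close>
  have ye: "y \<odot> e = 0"
  proof (rule four_torsion_free)
    show "y \<odot> e + y \<odot> e + y \<odot> e + y \<odot> e = 0"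
      using arg_cong[OF bb[unfolded eq_neg_iff_add_eq_0], of D]
      by (simp add: D_zero D_add D_mult Db Dq bilinear mult_commute[of c b] mult_commute[of d b] bc bd ac_simps)
  qed
  then have Dq0: "D q = 0" and bd0: "b \<odot> d = 0"
    by (simp_all add: Dq bd)
  have xq: "x \<odot> q = 0"
    using arg_cong[OF xe, of D] by (simp add: D_minus D_mult D_x De Dq0 ye)
  have yq: "y \<odot> q = 0"
    using arg_cong[OF xq, of D] by (simp add: D_zero D_mult D_x Dq0 bilinear)
  have be: "b \<odot> e = 0"
    using arg_cong[OF ye, of D] by (simp add: D_zero D_mult Dy De yq)
  \<comment> \<open>At \<open>u = x\<close>, \<open>v = d\<close> the other terms contain
    \<open>x \<odot> q\<close>, \<open>y \<odot> q\<close> or \<open>b \<odot> e\<close>, leaving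
    \<open>2 (c \<odot> d)\<close>.\<close>
  have cd: "c \<odot> d = 0"
    using form4[of x d] two_torsion_free[of "c \<odot> d"]
    by (simp add: xy xb xc xd xe xq x_x bilinear yq be)
  have cc: "c \<odot> c = 0"
    using arg_cong[OF bc, of D]
    by (simp add: D_zero D_mult Db Dc be bilinear cd mult_commute[of d c])
  have dd: "d \<odot> d = 0"
    using arg_cong[OF bd0, of D] by (simp add: D_zero D_mult Db Dd bilinear cd)
  have ed: "e \<odot> d = 0"
    using arg_cong[OF cd, of D] by (simp add: D_zero D_mult Dc Dd bilinear)
  have ce: "c \<odot> e = 0"
    using arg_cong[OF cc, of D] two_torsion_free[of "c \<odot> e"]
    by (simp add: D_zero D_mult Dc mult_commute[of e c])
  have qd: "q \<odot> d = 0"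
    using arg_cong[OF ed, of D] by (simp add: D_zero D_mult De Dd bilinear)
  have bq: "b \<odot> q = 0"
    using arg_cong[OF be, of D] by (simp add: D_zero D_mult Db De bilinear ce ed mult_commute[of d e])
  have cq: "c \<odot> q = 0"
    using arg_cong[OF bq, of D] by (simp add: D_zero D_mult Db Dq0 bilinear qd mult_commute[of d q])
  have ee: "e \<odot> e = 0"
    using arg_cong[OF ce, of D] by (simp add: D_zero D_mult Dc De cq)
  define e' where "e' = x \<odot> d'"
  define p where "p = y \<odot> d'"
  have d_half: "d = d' + d'" and e_half: "e = e' + e'" and q_half: "q = p + p"
    using half by (simp_all add: d_def e_def e'_def p_def bilinear half[symmetric] yd[symmetric])
  \<comment> \<open>The relations above concern \<open>d\<close> and \<open>e\<close>, but
    \<open>G\<close> contains their halves; torsion-freeness carries the vanishing over.\<close>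
  have halves: "v \<odot> u' = 0" if "v \<odot> u = 0" "u = u' + u'" for u u' v
    using that two_torsion_free[of "v \<odot> u'"] by (simp add: bilinear)
  have xe': "x \<odot> e' = - p"
  proof -
    have "(x \<odot> e' + p) + (x \<odot> e' + p) = 0"
      using xe by (simp add: e_half q_half bilinear ac_simps eq_neg_iff_add_eq_0)
    then show ?thesis
      unfolding eq_neg_iff_add_eq_0 by (rule two_torsion_free)
  qed
  have d'd': "d' \<odot> d' = 0"
    using halves[OF dd d_half] halves[of d' d d'] d_half by (simp add: mult_commute)
  have d'e': "d' \<odot> e' = 0"
    using halves[OF ed d_half] halves[of d' e e'] e_half by (simp add: mult_commute)
  have e'e': "e' \<odot> e' = 0"
    using halves[OF ee e_half] halves[of e' e e'] e_half by (simp add: mult_commute)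
  have G: "G = x + y + b + c + d' + e'"
    by (simp add: G_def b_def c_def e'_def ac_simps)
  note vanish = yb halves[OF ye e_half] bc halves[OF bd0 d_half] halves[OF be e_half]
    cc halves[OF cd d_half] halves[OF ce e_half] d'd' d'e' e'e'
  note known = xc xy xb x_x yy yc xe' vanish bb e'_def[symmetric] p_def[symmetric]
  \<comment> \<open>The summands are grouped by weight 1 to 9. From weight 6 on every product
    vanishes; in weight 5 the terms cancel as \<open>- 2 p + 2 q + 2 p - 2 q\<close>.\<close>
  have "G \<odot> G = x \<odot> x + (x \<odot> y + x \<odot> y) + (x \<odot> b + x \<odot> b + y \<odot> y)
    + (x \<odot> c + x \<odot> c + (x \<odot> d' + x \<odot> d') + (y \<odot> b + y \<odot> b))
    + (x \<odot> e' + x \<odot> e' + (y \<odot> c + y \<odot> c) + (y \<odot> d' + y \<odot> d') + b \<odot> b)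
    + (y \<odot> e' + y \<odot> e' + (b \<odot> c + b \<odot> c) + (b \<odot> d' + b \<odot> d'))
    + (b \<odot> e' + b \<odot> e' + c \<odot> c + (c \<odot> d' + c \<odot> d') + d' \<odot> d')
    + (c \<odot> e' + c \<odot> e' + (d' \<odot> e' + d' \<odot> e')) + e' \<odot> e'"
    unfolding G bilinear
    by (simp only: ac_simps mult_commute[of y x] mult_commute[of b x] mult_commute[of c x]
      mult_commute[of d' x] mult_commute[of e' x] mult_commute[of b y] mult_commute[of c y]
      mult_commute[of d' y] mult_commute[of e' y] mult_commute[of c b] mult_commute[of d' b]
      mult_commute[of e' b] mult_commute[of d' c] mult_commute[of e' c] mult_commute[of e' d'])
  also have "\<dots> = (y + y) + (b + b) + (c + c + (d' + d')) + (e' + e')"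
    by (simp add: known d_half q_half)
  also have "\<dots> = (G - x) + (G - x)"
    by (simp add: G ac_simps)
  finally show ?thesis ..
qed

end

section \<open>Polynomial calculus\<close>

lemma sum_single_lookup: "(\<Sum>k\<in>Poly_Mapping.keys p. Poly_Mapping.single k (Poly_Mapping.lookup p k)) = p"
  by (rule poly_mapping_eqI)
    (auto simp: lookup_sum lookup_single when_def in_keys_iff sum.If_cases Collect_conj_eq)

lemma mpoly_induct [case_names single add]:
  assumes "\<And>e c. P (Poly_Mapping.single e c)" and "\<And>p q. P p \<Longrightarrow> P q \<Longrightarrow> P (p + q)"
  shows "P (p :: 'e \<Rightarrow>\<^sub>0 'a::comm_monoid_add)"
proof -
  \<comment> \<open>The empty sum is covered by the monomial case with coefficient 0.\<close>
  have "P (\<Sum>k\<in>K. Poly_Mapping.single k (Poly_Mapping.lookup p k))" if "finite K" for K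
    using that assms assms(1)[of undefined 0] by (induction K) auto
  then show ?thesis
    using sum_single_lookup[of p] by (metis finite_keys)
qed

lemma mdeg_0 [simp]: "mdeg 0 = 0"
  by (simp add: mdeg_def)

lemma mdeg_eq_0_iff: "mdeg e = 0 \<longleftrightarrow> e = 0"
  by (auto simp: mdeg_def poly_mapping_eq_iff fun_eq_iff)

lemma mdeg_add: "mdeg (e + f) = mdeg e + mdeg f"
  by (simp add: mdeg_def lookup_add sum.distrib)

lemma mdeg_single [simp]: "mdeg (Poly_Mapping.single i k) = k"
  by (simp add: mdeg_def lookup_single when_def)

lemma minus_single_add:
  "Poly_Mapping.lookup e i \<noteq> 0 \<Longrightarrow> e - Poly_Mapping.single i (1::nat) + Poly_Mapping.single i 1 = e"
  by (rule poly_mapping_eqI) (auto simp: lookup_add lookup_minus lookup_single when_def)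

lemma lookup_Const: "Poly_Mapping.lookup (Const c) e = (if e = 0 then c else 0)"
  by (auto simp: Const_def lookup_single when_def)

lemma Const_0 [simp]: "Const 0 = 0" and Const_1 [simp]: "Const 1 = 1"
  by (simp_all add: Const_def)

lemma Const_add: "Const (a + b) = Const a + Const b"
  by (simp add: Const_def single_add)

lemma Const_mult: "Const (a * b) = Const a * Const b"
  by (simp add: Const_def mult_single)

section \<open>Partial derivatives\<close>

lemma partial_deriv_single:
  "partial_deriv i (Poly_Mapping.single e c) =
     Poly_Mapping.single (e - Poly_Mapping.single i 1) (of_nat (Poly_Mapping.lookup e i) * c)"
  by (simp add: partial_deriv_def)

lemma partial_deriv_add: "partial_deriv i (p + q) = partial_deriv i p + partial_deriv i q"
  unfolding partial_deriv_def
  by (rule setsum_keys_plus_distrib) (simp_all add: distrib_left single_add)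

lemma partial_deriv_0 [simp]: "partial_deriv i 0 = 0"
  by (simp add: partial_deriv_def)

lemma partial_deriv_minus: "partial_deriv i (- p) = - partial_deriv i p"
  using partial_deriv_add[of i p "- p"] by (simp add: minus_unique)

lemma partial_deriv_diff: "partial_deriv i (p - q) = partial_deriv i p - partial_deriv i q"
  using partial_deriv_add[of i p "- q"] by (simp add: partial_deriv_minus)

lemma partial_deriv_sum: "partial_deriv i (\<Sum>k\<in>A. f k) = (\<Sum>k\<in>A. partial_deriv i (f k))"
  by (induction A rule: infinite_finite_induct) (simp_all add: partial_deriv_add)

text \<open>Lowering an exponent commutes with adding exponent vectors only when the exponent is
  positive; when it is 0, subtraction truncates but the coefficient of that term is 0. Hence the
  case split.\<close>

lemma partial_deriv_mult_single:
  "partial_deriv i (Poly_Mapping.single e c * Poly_Mapping.single f d) =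
     partial_deriv i (Poly_Mapping.single e c) * Poly_Mapping.single f d +
     Poly_Mapping.single e c * partial_deriv i (Poly_Mapping.single f d)"
proof -
  let ?x = "Poly_Mapping.single i (1::nat)"
  have e: "Poly_Mapping.lookup e i \<noteq> 0 \<Longrightarrow> f + (e - ?x) = e + f - ?x"
    and f: "Poly_Mapping.lookup f i \<noteq> 0 \<Longrightarrow> e + (f - ?x) = e + f - ?x"
    by (auto intro!: poly_mapping_eqI simp: lookup_add lookup_minus lookup_single when_def)
  show ?thesis
    by (cases "Poly_Mapping.lookup e i = 0"; cases "Poly_Mapping.lookup f i = 0")
      (simp_all add: partial_deriv_single mult_single e[simplified] f[simplified] lookup_add
        single_add[symmetric] algebra_simps)
qed

lemma partial_deriv_mult: "partial_deriv i (p * q) = partial_deriv i p * q + p * partial_deriv i q"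
proof (induction p rule: mpoly_induct)
  case (single e c)
  show ?case
    by (induction q rule: mpoly_induct)
      (simp_all add: partial_deriv_mult_single partial_deriv_add distrib_left)
qed (simp add: partial_deriv_add distrib_right)

lemma partial_deriv_commute:
  "partial_deriv i (partial_deriv j p) = partial_deriv j (partial_deriv i p)"
proof (induction p rule: mpoly_induct)
  case (single e c)
  show ?case
    by (cases "i = j")
     (simp_all add: partial_deriv_single lookup_minus lookup_single when_def diff_diff_add 
        add.commute mult.left_commute)
qed (simp add: partial_deriv_add)

lemma partial_deriv_Const [simp]: "partial_deriv i (Const c) = 0"
  by (simp add: Const_def partial_deriv_single)

lemma partial_deriv_Var: "partial_deriv i (Var j) = (if i = j then 1 else 0)"
  by (simp add: Var_def partial_deriv_single lookup_single when_def)

section \<open>Homogeneous polynomials and Euler's identity\<close>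

lemma homogeneous_0 [simp]: "homogeneous d 0"
  by (simp add: homogeneous_def)

lemma homogeneous_single: "mdeg e = d \<Longrightarrow> homogeneous d (Poly_Mapping.single e c)"
  by (simp add: homogeneous_def)

lemma homogeneous_Const: "homogeneous 0 (Const c)"
  by (simp add: Const_def homogeneous_single)

lemma homogeneous_Var: "homogeneous 1 (Var i)"
  by (simp add: Var_def homogeneous_single)

lemma homogeneous_Xmap: "homogeneous 1 (Xmap $ i)"
  by (simp only: Xmap_def vec_lambda_beta homogeneous_Var)

lemma homogeneous_add: "homogeneous d p \<Longrightarrow> homogeneous d q \<Longrightarrow> homogeneous d (p + q)"
  using keys_add[of p q] by (auto simp: homogeneous_def)

lemma homogeneous_sum: "(\<And>k. k \<in> A \<Longrightarrow> homogeneous d (f k)) \<Longrightarrow> homogeneous d (sum f A)"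
  by (induction A rule: infinite_finite_induct) (simp_all add: homogeneous_add)

lemma homogeneous_mult: "homogeneous d p \<Longrightarrow> homogeneous d' q \<Longrightarrow> homogeneous (d + d') (p * q)"
  using keys_mult[of p q] by (fastforce simp: homogeneous_def mdeg_add)

lemma homogeneous_partial_deriv:
  assumes "homogeneous (Suc d) p"
  shows "homogeneous d (partial_deriv i p)"
  unfolding partial_deriv_def
proof (rule homogeneous_sum)
  fix e assume "e \<in> Poly_Mapping.keys p"
  then have *: "mdeg e = Suc d" using assms by (auto simp: homogeneous_def)
  show "homogeneous d (Poly_Mapping.single (e - Poly_Mapping.single i 1)
      (of_nat (Poly_Mapping.lookup e i) * Poly_Mapping.lookup p e))"
  proof (cases "Poly_Mapping.lookup e i = 0")
    case False
    with * have "mdeg (e - Poly_Mapping.single i 1) = d"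
      using mdeg_add[of "e - Poly_Mapping.single i 1" "Poly_Mapping.single i 1"]
      by (simp add: minus_single_add[OF False, simplified])
    then show ?thesis by (rule homogeneous_single)
  qed simp
qed

lemma homogeneous_0_eq_Const: "homogeneous 0 p \<Longrightarrow> p = Const (Poly_Mapping.lookup p 0)"
  by (rule poly_mapping_eqI) (auto simp: homogeneous_def lookup_Const in_keys_iff mdeg_eq_0_iff)

text \<open>\<open>X_i D_i\<close> multiplies each monomial by its \<open>i\<close>-th exponent, and
  these exponents add up to the degree.\<close>

lemma euler_homogeneous:
  fixes p :: "('n::finite, 'a::comm_ring_1) mpoly"
  assumes "homogeneous d p"
  shows "(\<Sum>i\<in>UNIV. Var i * partial_deriv i p) = of_nat d * p"
proof -
  have single: "Var i * Poly_Mapping.single (e - Poly_Mapping.single i 1) (of_nat (Poly_Mapping.lookup e i) * c)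
      = of_nat (Poly_Mapping.lookup e i) * Poly_Mapping.single e c" for i :: 'n and e and c :: 'a
    using minus_single_add[of e i]
    by (cases "Poly_Mapping.lookup e i = 0")
      (simp_all add: Var_def mult_single add.commute flip: single_of_nat)
  have "(\<Sum>i\<in>UNIV. Var i * partial_deriv i p)
      = (\<Sum>i\<in>UNIV. \<Sum>e\<in>Poly_Mapping.keys p.
          of_nat (Poly_Mapping.lookup e i) * Poly_Mapping.single e (Poly_Mapping.lookup p e))"
    by (simp only: partial_deriv_def sum_distrib_left single)
  also have "\<dots> = (\<Sum>e\<in>Poly_Mapping.keys p. of_nat (mdeg e) * Poly_Mapping.single e (Poly_Mapping.lookup p e))"
    by (subst sum.swap) (simp add: mdeg_def sum_distrib_right)
  also have "\<dots> = of_nat d * p"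
    using assms by (simp add: homogeneous_def sum_distrib_left[symmetric] sum_single_lookup)
  finally show ?thesis .
qed

section \<open>Evaluation in commutative algebras\<close>

text \<open>Instantiated with \<open>Const\<close> for points in polynomials and with
  \<open>mps_const\<close> for points in power series, so that one injectivity proof serves
  both.\<close>

definition peval :: "('a \<Rightarrow> 's) \<Rightarrow> ('n::finite, 'a::comm_ring_1) mpoly \<Rightarrow> 's::comm_ring_1 ^ 'n \<Rightarrow> 's" where
  "peval \<phi> p g = (\<Sum>e\<in>Poly_Mapping.keys p.
     \<phi> (Poly_Mapping.lookup p e) * (\<Prod>i\<in>UNIV. (g $ i) ^ Poly_Mapping.lookup e i))"

lemma mpoly_subst_eq_peval: "mpoly_subst p G = peval Const p G"
  by (simp add: mpoly_subst_def peval_def)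

text \<open>For quadratic \<open>H\<close> the second derivative is a constant polynomial; taking
  its constant term gives an element of the coefficient ring, to which \<open>\<phi>\<close>
  applies.\<close>

definition quad_coeff :: "('n::finite, 'a::comm_ring_1) poly_map \<Rightarrow> 'n \<Rightarrow> 'n \<Rightarrow> 'n \<Rightarrow> 'a" where
  "quad_coeff H w i j = Poly_Mapping.lookup (partial_deriv i (partial_deriv j (H $ w))) 0"

text \<open>For \<open>H\<close> homogeneous of degree 2, this is the bilinear map with \<open>polar \<phi> H u u = 2 H(u)\<close>.\<close>

definition polar ::
    "('a \<Rightarrow> 's) \<Rightarrow> ('n::finite, 'a::comm_ring_1) poly_map \<Rightarrow> 's::comm_ring_1 ^ 'n \<Rightarrow> 's ^ 'n \<Rightarrow> 's ^ 'n"
  where "polar \<phi> H u v = (\<chi> w. \<Sum>i\<in>UNIV. \<Sum>j\<in>UNIV. \<phi> (quad_coeff H w i j) * u $ i * v $ j)"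

lemma polar_commute: "polar \<phi> H u v = polar \<phi> H v u"
proof -
  have "quad_coeff H w i j = quad_coeff H w j i" for w i j
    by (simp add: quad_coeff_def partial_deriv_commute[of i j])
  then show ?thesis
    unfolding polar_def vec_eq_iff vec_lambda_beta
    by (subst sum.swap) (simp add: mult.assoc mult.left_commute mult.commute)
qed

lemma polar_add_left: "polar \<phi> H (u + v) w = polar \<phi> H u w + polar \<phi> H v w"
  by (simp add: polar_def vec_eq_iff algebra_simps sum.distrib)

lemma polar_minus_left: "polar \<phi> H (- u) w = - polar \<phi> H u w"
  by (simp add: polar_def vec_eq_iff sum_negf)

lemma polar_add_right: "polar \<phi> H w (u + v) = polar \<phi> H w u + polar \<phi> H w v"
  by (simp add: polar_add_left polar_commute[of _ _ w])

lemma polar_diff_left: "polar \<phi> H (u - v) w = polar \<phi> H u w - polar \<phi> H v w"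
  using polar_add_left[of \<phi> H u "- v" w] by (simp add: polar_minus_left)

lemma polar_diff_right: "polar \<phi> H w (u - v) = polar \<phi> H w u - polar \<phi> H w v"
  by (simp add: polar_diff_left polar_commute[of _ _ w])

section \<open>Evaluation as a ring homomorphism\<close>

locale coeff_hom =
  fixes \<phi> :: "'a::comm_ring_1 \<Rightarrow> 's::comm_ring_1"
  assumes hom_add: "\<phi> (a + b) = \<phi> a + \<phi> b"
    and hom_mult: "\<phi> (a * b) = \<phi> a * \<phi> b"
    and hom_1: "\<phi> 1 = 1"
begin

lemma hom_0: "\<phi> 0 = 0"
  using hom_add[of 0 0] by simp

lemma peval_single:
  "peval \<phi> (Poly_Mapping.single e c) g = \<phi> c * (\<Prod>i\<in>UNIV. (g $ i) ^ Poly_Mapping.lookup e i)"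
  by (simp add: peval_def hom_0)

lemma peval_add: "peval \<phi> (p + q) g = peval \<phi> p g + peval \<phi> q g"
  unfolding peval_def
  by (rule setsum_keys_plus_distrib) (simp_all add: distrib_right hom_0 hom_add)

lemma peval_0 [simp]: "peval \<phi> 0 g = 0"
  by (simp add: peval_def)

lemma peval_diff: "peval \<phi> (p - q) g = peval \<phi> p g - peval \<phi> q g"
  using peval_add[of "p - q" q g] by simp

lemma peval_sum: "peval \<phi> (\<Sum>k\<in>A. f k) g = (\<Sum>k\<in>A. peval \<phi> (f k) g)"
  by (induction A rule: infinite_finite_induct) (simp_all add: peval_add)

lemma peval_Const [simp]: "peval \<phi> (Const c) g = \<phi> c"
  by (simp add: Const_def peval_single)

lemma peval_1 [simp]: "peval \<phi> 1 g = 1"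
  using peval_Const[of 1] by (simp add: hom_1)

lemma peval_Var [simp]: "peval \<phi> (Var i) g = g $ i"
proof -
  have "(\<Prod>k\<in>UNIV. (g $ k) ^ Poly_Mapping.lookup (Poly_Mapping.single i 1) k)
      = (\<Prod>k\<in>UNIV. if i = k then g $ k else 1)"
    by (rule prod.cong) (auto simp: lookup_single when_def)
  then show ?thesis
    by (simp add: Var_def peval_single hom_1)
qed

lemma peval_mult: "peval \<phi> (p * q) g = peval \<phi> p g * peval \<phi> q g"
proof (induction p rule: mpoly_induct)
  case (single e c)
  show ?case
    by (induction q rule: mpoly_induct)
      (simp_all add: mult_single peval_single hom_mult lookup_add power_add prod.distrib
        peval_add algebra_simps)
qed (simp add: peval_add distrib_right)

lemma peval_power: "peval \<phi> (p ^ k) g = peval \<phi> p g ^ k"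
  by (induction k) (simp_all add: peval_mult)

lemma peval_prod: "peval \<phi> (\<Prod>k\<in>A. f k) g = (\<Prod>k\<in>A. peval \<phi> (f k) g)"
  by (induction A rule: infinite_finite_induct) (simp_all add: peval_mult)

lemma peval_mpoly_subst: "peval \<phi> (mpoly_subst p G) g = peval \<phi> p (\<chi> i. peval \<phi> (G $ i) g)"
  unfolding mpoly_subst_def peval_def[of \<phi> p]
  by (simp add: peval_sum peval_mult peval_prod peval_power)

text \<open>Euler's identity in degree 1, where the partial derivatives are constants.\<close>

lemma peval_linear:
  assumes "homogeneous 1 p"
  shows "peval \<phi> p g = (\<Sum>i\<in>UNIV. \<phi> (Poly_Mapping.lookup (partial_deriv i p) 0) * g $ i)"
proof -
  have "p = (\<Sum>i\<in>UNIV. Var i * partial_deriv i p)"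
    using euler_homogeneous[OF assms] by simp
  also have "\<dots> = (\<Sum>i\<in>UNIV. Var i * Const (Poly_Mapping.lookup (partial_deriv i p) 0))"
    using assms by (intro sum.cong refl arg_cong2[where f = times] homogeneous_0_eq_Const
        homogeneous_partial_deriv) simp_all
  finally have "peval \<phi> p g = peval \<phi> \<dots> g"
    by (rule arg_cong)
  then show ?thesis
    by (simp add: peval_sum peval_mult mult.commute)
qed

end

lemma prod_Var_power:
  "(\<Prod>i\<in>UNIV. Var i ^ Poly_Mapping.lookup e i) =
     (Poly_Mapping.single e 1 :: ('n::finite, 'a::comm_ring_1) mpoly)"
proof -
  have power: "(Var i :: ('n, 'a) mpoly) ^ k = Poly_Mapping.single (Poly_Mapping.single i k) 1" for i k
    by (induction k) (simp_all add: Var_def mult_single single_add[symmetric])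
  have "(\<Prod>i\<in>A. (Var i :: ('n, 'a) mpoly) ^ Poly_Mapping.lookup e i)
      = Poly_Mapping.single (\<Sum>i\<in>A. Poly_Mapping.single i (Poly_Mapping.lookup e i)) 1" for A
    by (induction A rule: infinite_finite_induct) (simp_all add: power mult_single)
  moreover have "(\<Sum>i\<in>UNIV. Poly_Mapping.single i (Poly_Mapping.lookup e i)) = e"
    by (rule poly_mapping_eqI) (simp add: lookup_sum lookup_single when_def)
  ultimately show ?thesis by simp
qed

lemma peval_Xmap [simp]: "peval Const p Xmap = p"
proof -
  have "peval Const p Xmap
      = (\<Sum>e\<in>Poly_Mapping.keys p. Poly_Mapping.single e (Poly_Mapping.lookup p e))"
    by (simp add: peval_def Xmap_def prod_Var_power Const_def mult_single)
  then show ?thesis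
    by (simp add: sum_single_lookup)
qed

section \<open>Symmetric quadratic maps and their evaluated Jacobians\<close>

definition mat_deriv :: "'n \<Rightarrow> ('n::finite, 'a::comm_ring_1) mpoly ^ 'n ^ 'n \<Rightarrow> ('n, 'a) mpoly ^ 'n ^ 'n" where
  "mat_deriv w A = (\<chi> i j. partial_deriv w (A $ i $ j))"

locale symmetric_quadratic_map =
  fixes H :: "('n::finite, 'a::comm_ring_1) poly_map"
  assumes quadratic: "homogeneous 2 (H $ i)"
    and symmetric: "transpose (jacobian H) = jacobian H"
    and nilpotent: "jacobian H ** jacobian H ** jacobian H ** jacobian H = 0"
begin

lemma jacobian_symmetric: "partial_deriv i (H $ j) = partial_deriv j (H $ i)"
  using arg_cong[OF symmetric, of "\<lambda>M. M $ j $ i"] by (simp add: jacobian_def transpose_def)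

lemma homogeneous_jacobian: "homogeneous 1 (partial_deriv i (H $ j))"
  using quadratic by (intro homogeneous_partial_deriv) (simp add: numeral_2_eq_2)

end

locale symmetric_quadratic_eval = symmetric_quadratic_map H + coeff_hom \<phi>
  for H :: "('n::finite, 'a::comm_ring_1) poly_map" and \<phi> :: "'a \<Rightarrow> 's::comm_ring_1" +
  assumes two_torsion_free: "(s::'s) + s = 0 \<Longrightarrow> s = 0"
begin

abbreviation eval_jacobian :: "'s ^ 'n \<Rightarrow> 's ^ 'n ^ 'n" where
  "eval_jacobian z \<equiv> (\<chi> i j. peval \<phi> (jacobian H $ i $ j) z)"

text \<open>Each Jacobian entry is a linear form; symmetry of the Jacobian turns its coefficients
  into those of \<open>polar\<close>.\<close>

lemma eval_jacobian_mult: "eval_jacobian z *v v = polar \<phi> H z v"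
proof -
  have "peval \<phi> (jacobian H $ w $ j) z = (\<Sum>i\<in>UNIV. \<phi> (quad_coeff H w i j) * z $ i)" for w j
    using peval_linear[OF homogeneous_jacobian[of w j], of z]
    by (simp add: jacobian_def quad_coeff_def jacobian_symmetric[of j w])
  then show ?thesis
    unfolding polar_def vec_eq_iff matrix_vector_mult_def vec_lambda_beta
    by (subst sum.swap) (simp add: sum_distrib_right)
qed

text \<open>Euler's identity in degree 2, with symmetry rewriting its left side as the Jacobian
  applied to \<open>X\<close>.\<close>

lemma polar_diag: "polar \<phi> H z z $ i = peval \<phi> (H $ i) z + peval \<phi> (H $ i) z"
proof -
  have "H $ i + H $ i = (\<Sum>j\<in>UNIV. Var j * partial_deriv j (H $ i))"
    using euler_homogeneous[OF quadratic[of i]] by simp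
  also have "\<dots> = (\<Sum>j\<in>UNIV. partial_deriv i (H $ j) * Var j)"
    by (intro sum.cong refl) (subst jacobian_symmetric, rule mult.commute)
  finally have "peval \<phi> (H $ i + H $ i) z = (eval_jacobian z *v z) $ i"
    by (simp only: peval_sum peval_mult peval_Var matrix_vector_mult_def jacobian_def vec_lambda_beta)
  then show ?thesis
    by (simp only: eval_jacobian_mult peval_add)
qed

text \<open>Entrywise evaluation respects matrix products, so the evaluated Jacobian inherits
  nilpotency.\<close>

lemma polar_nilpotent:
  "polar \<phi> H z (polar \<phi> H z (polar \<phi> H z (polar \<phi> H z v))) = 0"
proof -
  have mult: "(\<chi> i j. peval \<phi> (A $ i $ j) z) ** (\<chi> i j. peval \<phi> (B $ i $ j) z)
      = (\<chi> i j. peval \<phi> ((A ** B) $ i $ j) z)"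
    for A B :: "('n, 'a) mpoly ^ 'n ^ 'n"
    by (simp add: matrix_matrix_mult_def peval_sum peval_mult vec_eq_iff)
  have "eval_jacobian z ** eval_jacobian z ** eval_jacobian z ** eval_jacobian z = 0"
    unfolding mult nilpotent by (simp add: vec_eq_iff)
  then show ?thesis
    unfolding eval_jacobian_mult[symmetric] matrix_vector_mul_assoc
    by (simp add: matrix_mul_assoc)
qed

lemma vec_two_torsion_free: "(v::'s ^ 'n) + v = 0 \<Longrightarrow> v = 0"
  by (simp add: vec_eq_iff two_torsion_free)

text \<open>
  With \<open>d = A - B\<close> and \<open>L = polar \<phi> H (A + B)\<close>, polarization turns the hypothesis into \<open>L d = 2 d\<close>,
  while \<open>L\<^sup>4 = 0\<close>.
\<close>

lemma quadratic_map_inj: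
  assumes "\<And>i. A $ i - peval \<phi> (H $ i) A = B $ i - peval \<phi> (H $ i) B"
  shows "A = B"
proof -
  define d where "d = A - B"
  let ?L = "polar \<phi> H (A + B)"
  have d: "d $ i = peval \<phi> (H $ i) A - peval \<phi> (H $ i) B" for i
    using assms[of i] by (simp add: d_def algebra_simps)
  have "(d + d) $ i = (polar \<phi> H A A - polar \<phi> H B B) $ i" for i
    by (simp only: vector_add_component vector_minus_component polar_diag d algebra_simps)
  then have "d + d = polar \<phi> H A A - polar \<phi> H B B"
    unfolding vec_eq_iff by blast
  then have L: "?L d = d + d"
    by (simp add: d_def polar_add_left polar_diff_right polar_commute[of _ _ B A])
  \<comment> \<open>This vector is also \<open>16 d\<close>; writing it as four nested doublings
    lets torsion-freeness be applied four times.\<close>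
  have "?L (?L (?L (?L d))) = 0"
    by (rule polar_nilpotent)
  then have "((d + d) + (d + d)) + ((d + d) + (d + d))
      + (((d + d) + (d + d)) + ((d + d) + (d + d))) = 0"
    by (simp only: L polar_add_right)
  then have "d = 0"
    by (rule vec_two_torsion_free[THEN vec_two_torsion_free,
          THEN vec_two_torsion_free, THEN vec_two_torsion_free])
  then show ?thesis
    by (simp add: d_def)
qed

end

section \<open>Power series\<close>

lemma coeff_mps_of_mpoly [simp]: "coeff (mps_of_mpoly p) e = Poly_Mapping.lookup p e"
  by (simp add: mps_of_mpoly_def)

lemma coeff_add: "coeff (f + g) e = coeff f e + coeff g e"
  by (simp add: plus_mps_def)

lemma coeff_0 [simp]: "coeff 0 e = 0"
  by (simp add: zero_mps_def)

lemma coeff_sum: "coeff (\<Sum>k\<in>A. f k) e = (\<Sum>k\<in>A. coeff (f k) e)"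
  by (induction A rule: infinite_finite_induct) (simp_all add: coeff_add)

lemma coeff_mult: "coeff (f * g) e = (\<Sum>(a, b)\<in>antidiag e. coeff f a * coeff g b)"
  by (simp add: times_mps_def)

section \<open>The embedding of polynomials into power series\<close>

lemma mps_of_mpoly_add: "mps_of_mpoly (p + q) = mps_of_mpoly p + mps_of_mpoly q"
  by (rule mps_eqI) (simp add: coeff_add lookup_add)

lemma mps_of_mpoly_0 [simp]: "mps_of_mpoly 0 = 0"
  by (rule mps_eqI) simp

lemma mps_of_mpoly_1 [simp]: "mps_of_mpoly 1 = 1"
  by (rule mps_eqI) (simp add: one_mps_def lookup_one when_def)

lemma mps_of_mpoly_mult_single:
  "mps_of_mpoly (Poly_Mapping.single a c * Poly_Mapping.single b d) =
     mps_of_mpoly (Poly_Mapping.single a c) * mps_of_mpoly (Poly_Mapping.single b d)"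
proof (rule mps_eqI)
  fix e
  have "(\<Sum>(x, y)\<in>antidiag e. Poly_Mapping.lookup (Poly_Mapping.single a c) x *
      Poly_Mapping.lookup (Poly_Mapping.single b d) y)
    = (\<Sum>z\<in>antidiag e. if z = (a, b) then c * d else 0)"
    by (intro sum.cong) (auto simp: lookup_single when_def split: if_splits)
  also have "\<dots> = (if a + b = e then c * d else 0)"
    by (subst sum.delta[OF finite_antidiag]) (simp add: antidiag_def)
  finally show "coeff (mps_of_mpoly (Poly_Mapping.single a c * Poly_Mapping.single b d)) e =
      coeff (mps_of_mpoly (Poly_Mapping.single a c) * mps_of_mpoly (Poly_Mapping.single b d)) e"
    by (simp add: coeff_mult mult_single lookup_single when_def)
qed

lemma mps_of_mpoly_mult: "mps_of_mpoly (p * q) = mps_of_mpoly p * mps_of_mpoly q"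
proof (induction p rule: mpoly_induct)
  case (single e c)
  show ?case
    by (induction q rule: mpoly_induct)
      (simp_all add: mps_of_mpoly_mult_single mps_of_mpoly_add distrib_left)
qed (simp add: mps_of_mpoly_add distrib_right)

lemma mps_of_mpoly_sum: "mps_of_mpoly (\<Sum>k\<in>A. f k) = (\<Sum>k\<in>A. mps_of_mpoly (f k))"
  by (induction A rule: infinite_finite_induct) (simp_all add: mps_of_mpoly_add)

lemma mps_of_mpoly_power: "mps_of_mpoly (p ^ k) = mps_of_mpoly p ^ k"
  by (induction k) (simp_all add: mps_of_mpoly_mult)

lemma mps_of_mpoly_prod: "mps_of_mpoly (\<Prod>k\<in>A. f k) = (\<Prod>k\<in>A. mps_of_mpoly (f k))"
  by (induction A rule: infinite_finite_induct) (simp_all add: mps_of_mpoly_mult)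

abbreviation mps_const :: "'a \<Rightarrow> ('n::finite, 'a::comm_ring_1) mps" where
  "mps_const c \<equiv> mps_of_mpoly (Const c)"

lemma coeff_mps_const_mult:
  fixes f :: "('n::finite, 'a::comm_ring_1) mps"
  shows "coeff (mps_const c * f) e = c * coeff f e"
proof -
  have "coeff (mps_const c * f) e = (\<Sum>(a, b)\<in>{(0 :: 'n monom, e)}. (if a = 0 then c else 0) * coeff f b)"
    unfolding coeff_mult coeff_mps_of_mpoly lookup_Const
    by (rule sum.mono_neutral_right[OF finite_antidiag])
      (auto simp: antidiag_def split: if_splits)
  then show ?thesis by simp
qed

section \<open>Orders of products, and substitution as evaluation\<close>

lemma coeff_mult_low_order:
  assumes "\<And>e. mdeg e < m \<Longrightarrow> coeff f e = 0" "\<And>e. mdeg e < n \<Longrightarrow> coeff g e = 0" "mdeg e < m + n"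
  shows "coeff (f * g) e = 0"
  unfolding coeff_mult
proof (rule sum.neutral, clarify)
  fix a b assume "(a, b) \<in> antidiag e"
  then have "mdeg a < m \<or> mdeg b < n"
    using assms(3) by (auto simp: antidiag_def mdeg_add)
  then show "coeff f a * coeff g b = 0"
    using assms(1,2) by auto
qed

lemma coeff_power_low_order:
  assumes "coeff f 0 = 0" "mdeg e < k"
  shows "coeff (f ^ k) e = 0"
  using assms(2)
proof (induction k arbitrary: e)
  case (Suc k)
  have "coeff (f * f ^ k) e = 0"
    by (rule coeff_mult_low_order[of 1 f k])
      (use assms(1) Suc in \<open>auto simp: mdeg_eq_0_iff\<close>)
  then show ?case by simp
qed simp

lemma coeff_prod_power_low_order:
  assumes "\<And>i. coeff (g i) 0 = 0" "finite A" "mdeg e < sum k A"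
  shows "coeff (\<Prod>i\<in>A. g i ^ k i) e = 0"
  using assms(2,3)
proof (induction A arbitrary: e)
  case (insert a A)
  have "coeff (g a ^ k a * (\<Prod>i\<in>A. g i ^ k i)) e = 0"
    by (rule coeff_mult_low_order[of "k a" _ "sum k A"])
      (use insert in \<open>auto intro: coeff_power_low_order assms(1)\<close>)
  then show ?case
    using insert.hyps by simp
qed simp

text \<open>Without constant terms in \<open>g\<close>, the monomial of exponent \<open>k\<close>
  has order at least \<open>mdeg k\<close>, so the terms cut off in \<open>mps_subst\<close>
  contribute nothing.\<close>

lemma mps_subst_mps_of_mpoly:
  assumes "\<And>i. coeff (g $ i) 0 = 0"
  shows "mps_subst (mps_of_mpoly p) g = peval mps_const p g"
proof (rule mps_eqI)
  fix e
  have "(\<Sum>k | mdeg k \<le> mdeg e. Poly_Mapping.lookup p k *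
        coeff (\<Prod>i\<in>UNIV. (g $ i) ^ Poly_Mapping.lookup k i) e)
      = (\<Sum>k\<in>Poly_Mapping.keys p. Poly_Mapping.lookup p k *
        coeff (\<Prod>i\<in>UNIV. (g $ i) ^ Poly_Mapping.lookup k i) e)"
  proof (rule sum.mono_neutral_cong)
    fix k assume "k \<in> Poly_Mapping.keys p - {k. mdeg k \<le> mdeg e}"
    then show "Poly_Mapping.lookup p k * coeff (\<Prod>i\<in>UNIV. (g $ i) ^ Poly_Mapping.lookup k i) e = 0"
      using coeff_prod_power_low_order[of "\<lambda>i. g $ i" UNIV e "Poly_Mapping.lookup k"] assms
      by (simp add: mdeg_def)
  qed (auto simp: in_keys_iff)
  then show "coeff (mps_subst (mps_of_mpoly p) g) e = coeff (peval mps_const p g) e"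
    by (simp add: mps_subst_def peval_def coeff_sum coeff_mps_const_mult)
qed

lemma peval_formal_map: "peval mps_const p (formal_map G) = mps_of_mpoly (mpoly_subst p G)"
  by (simp add: peval_def mpoly_subst_def formal_map_def mps_of_mpoly_sum mps_of_mpoly_mult
      mps_of_mpoly_prod mps_of_mpoly_power)

lemma mps_map_comp_formal_map:
  assumes "\<And>i. Poly_Mapping.lookup (G $ i) 0 = 0"
  shows "mps_map_comp (formal_map F) (formal_map G) = formal_map (poly_map_comp F G)"
proof -
  have "coeff (formal_map G $ i) 0 = 0" for i
    using assms by (simp add: formal_map_def)
  from mps_subst_mps_of_mpoly[OF this] show ?thesis
    by (simp add: mps_map_comp_def poly_map_comp_def peval_formal_map vec_eq_iff)
      (simp add: formal_map_def peval_formal_map)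
qed

lemma lookup_hom_component:
  "Poly_Mapping.lookup (hom_component d f) e = (if mdeg e = d then coeff f e else 0)"
  by (simp add: hom_component_def lookup_sum lookup_single when_def)

lemma homogeneous_lookup: "homogeneous d p \<Longrightarrow> mdeg e \<noteq> d \<Longrightarrow> Poly_Mapping.lookup p e = 0"
  by (auto simp: homogeneous_def in_keys_iff)

interpretation Const: coeff_hom Const
  by unfold_locales (simp_all add: Const_add Const_mult)

interpretation mps_const: coeff_hom mps_const
  by unfold_locales (simp_all add: Const_add Const_mult mps_of_mpoly_add mps_of_mpoly_mult)

section \<open>The derivation along \<open>H\<close>\<close>

lemma matrix_mult_add_left: "(A + B) ** C = A ** C + B ** (C :: 'a::comm_ring_1 ^ 'n ^ 'm)"
  by (simp add: matrix_matrix_mult_def vec_eq_iff distrib_right sum.distrib)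

lemma mat_deriv_mult: "mat_deriv w (A ** B) = mat_deriv w A ** B + A ** mat_deriv w B"
  by (simp add: mat_deriv_def matrix_matrix_mult_def vec_eq_iff partial_deriv_sum
      partial_deriv_mult sum.distrib)

definition dot :: "'a::comm_ring_1 ^ 'n \<Rightarrow> 'a ^ 'n \<Rightarrow> 'a" where
  "dot u v = (\<Sum>i\<in>UNIV. u $ i * v $ i)"

lemma dot_add_right: "dot u (v + w) = dot u v + dot u w"
  by (simp add: dot_def distrib_left sum.distrib)

lemma dot_0_right: "dot u 0 = 0"
  by (simp add: dot_def)

lemma dot_matrix_symmetric:
  assumes "transpose A = A"
  shows "dot u (A *v v) = dot (A *v u) v"
proof -
  have "A $ i $ j = A $ j $ i" for i j
    using arg_cong[OF assms, of "\<lambda>M. M $ j $ i"] by (simp add: transpose_def)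
  then have "(\<Sum>i\<in>UNIV. \<Sum>j\<in>UNIV. u $ i * (A $ i $ j * v $ j))
      = (\<Sum>i\<in>UNIV. \<Sum>j\<in>UNIV. A $ j $ i * u $ i * v $ j)"
    by (intro sum.cong refl) (simp add: mult.assoc mult.left_commute)
  also have "\<dots> = (\<Sum>j\<in>UNIV. \<Sum>i\<in>UNIV. A $ j $ i * u $ i * v $ j)"
    by (rule sum.swap)
  finally show ?thesis
    by (simp add: dot_def matrix_vector_mult_def sum_distrib_left sum_distrib_right)
qed

definition scalar_deriv_along ::
    "('n::finite, 'a::comm_ring_1) poly_map \<Rightarrow> ('n, 'a) mpoly \<Rightarrow> ('n, 'a) mpoly" where
  "scalar_deriv_along H p = (\<Sum>j\<in>UNIV. H $ j * partial_deriv j p)"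

definition deriv_along ::
    "('n::finite, 'a::comm_ring_1) poly_map \<Rightarrow> ('n, 'a) poly_map \<Rightarrow> ('n, 'a) poly_map" where
  "deriv_along H u = (\<chi> i. scalar_deriv_along H (u $ i))"

lemma scalar_deriv_along_add:
  "scalar_deriv_along H (p + q) = scalar_deriv_along H p + scalar_deriv_along H q"
  by (simp add: scalar_deriv_along_def partial_deriv_add distrib_left sum.distrib)

lemma scalar_deriv_along_sum:
  "scalar_deriv_along H (\<Sum>k\<in>A. f k) = (\<Sum>k\<in>A. scalar_deriv_along H (f k))"
  by (induction A rule: infinite_finite_induct)
    (simp_all add: scalar_deriv_along_add, simp_all add: scalar_deriv_along_def)

lemma scalar_deriv_along_mult:
  "scalar_deriv_along H (p * q) = scalar_deriv_along H p * q + p * scalar_deriv_along H q"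
  by (simp add: scalar_deriv_along_def partial_deriv_mult sum.distrib sum_distrib_left
      sum_distrib_right algebra_simps)

lemma scalar_deriv_along_Const: "scalar_deriv_along H (Const c) = 0"
  by (simp add: scalar_deriv_along_def)

lemma deriv_along_add: "deriv_along H (u + v) = deriv_along H u + deriv_along H v"
  by (simp add: deriv_along_def vec_eq_iff scalar_deriv_along_add)

text \<open>The coefficients of \<open>polar\<close> are constants, which the derivation kills, so
  only the two arguments are differentiated.\<close>

lemma deriv_along_polar:
  "deriv_along H (polar Const H' u v) =
     polar Const H' (deriv_along H u) v + polar Const H' u (deriv_along H v)"
  by (simp add: deriv_along_def polar_def vec_eq_iff scalar_deriv_along_sum
      scalar_deriv_along_mult scalar_deriv_along_Const sum.distrib algebra_simps)

lemma deriv_along_Xmap: "deriv_along H Xmap = H"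
proof -
  have "H $ j * (if j = i then 1 else 0) = (if j = i then H $ j else 0)" for i j
    by simp
  then show ?thesis
    by (simp add: deriv_along_def scalar_deriv_along_def Xmap_def partial_deriv_Var vec_eq_iff)
qed

lemma homogeneous_polar:
  assumes "\<And>i. homogeneous k (u $ i)" "\<And>i. homogeneous l (v $ i)"
    and "k + l = m"
  shows "homogeneous m (polar Const H u v $ w)"
proof -
  have "homogeneous (0 + k + l) (Const c * u $ i * v $ j)" for c i j
    by (intro homogeneous_mult homogeneous_Const assms)
  then show ?thesis
    by (simp add: polar_def homogeneous_sum assms(3))
qed

context symmetric_quadratic_map
begin

text \<open>With a symmetric Jacobian the second derivatives of \<open>H\<close> are symmetric in
  all three indices. This links the product \<open>polar\<close> to derivatives of the
  Jacobian.\<close>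

lemma Const_quad_coeff: "Const (quad_coeff H w i j) = partial_deriv w (jacobian H $ i $ j)"
proof -
  have "homogeneous 0 (partial_deriv i (partial_deriv j (H $ w)))"
    using quadratic by (intro homogeneous_partial_deriv) (simp add: numeral_2_eq_2)
  then have "Const (quad_coeff H w i j) = partial_deriv i (partial_deriv j (H $ w))"
    unfolding quad_coeff_def by (rule homogeneous_0_eq_Const[symmetric])
  also have "\<dots> = partial_deriv w (partial_deriv i (H $ j))"
    by (subst jacobian_symmetric) (rule partial_deriv_commute)
  finally show ?thesis
    by (simp add: jacobian_def)
qed

lemma polar_eq_dot: "polar Const H u v $ w = dot u (mat_deriv w (jacobian H) *v v)"
  by (simp add: polar_def Const_quad_coeff dot_def mat_deriv_def matrix_vector_mult_def
      sum_distrib_left ac_simps)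

text \<open>Differentiating \<open>u\<^sup>T J\<^sup>4 v = 0\<close> by \<open>X\<^sub>w\<close> with \<open>u\<close>, \<open>v\<close> held constant, and moving the left factors \<open>J\<close> to \<open>u\<close>.\<close>

lemma jacobian_form_identity:
  fixes u v :: "('n, 'a) poly_map"
  defines "J \<equiv> \<lambda>v. jacobian H *v v"
  shows "polar Const H u (J (J (J v))) + polar Const H (J u) (J (J v))
    + polar Const H (J (J u)) (J v) + polar Const H (J (J (J u))) v = 0"
proof -
  let ?J = "jacobian H"
  have "mat_deriv w ?J ** ?J ** ?J ** ?J + ?J ** mat_deriv w ?J ** ?J ** ?J
      + ?J ** ?J ** mat_deriv w ?J ** ?J + ?J ** ?J ** ?J ** mat_deriv w ?J = 0" for w
  proof -
    have "mat_deriv w (?J ** ?J ** ?J ** ?J) = 0"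
      unfolding nilpotent by (simp add: mat_deriv_def vec_eq_iff)
    then show ?thesis
      by (simp add: mat_deriv_mult matrix_mult_add_left)
  qed
  then have "dot u ((mat_deriv w ?J ** ?J ** ?J ** ?J + ?J ** mat_deriv w ?J ** ?J ** ?J
      + ?J ** ?J ** mat_deriv w ?J ** ?J + ?J ** ?J ** ?J ** mat_deriv w ?J) *v v) = 0" for w
    by (simp add: dot_0_right)
  then show ?thesis
    unfolding vec_eq_iff J_def
    by (simp add: polar_eq_dot matrix_vector_mult_add_rdistrib dot_add_right
        matrix_vector_mul_assoc[symmetric] dot_matrix_symmetric[OF symmetric])
qed

end

section \<open>The inverse\<close>

lemma half_two_torsion_free:
  assumes "(h::'a::comm_ring_1) + h = 1" "(s::'a) + s = 0"
  shows "s = 0"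
proof -
  have "s = (h + h) * s" by (simp add: assms(1))
  also have "\<dots> = h * (s + s)" by (simp only: distrib_left distrib_right)
  finally show ?thesis by (simp add: assms(2))
qed

text \<open>The element \<open>h\<close> stands for 1/2: it yields torsion-freeness for polynomials
  and power series, and the half of \<open>polar Const H H H\<close> in the inverse.\<close>

locale halved_symmetric_quadratic_map = symmetric_quadratic_map H
  for H :: "('n::finite, 'a::comm_ring_1) poly_map" +
  fixes h :: 'a
  assumes half: "h + h = 1"
begin

lemma mpoly_two_torsion_free: "(p :: ('n, 'a) mpoly) + p = 0 \<Longrightarrow> p = 0"
  using half_two_torsion_free[OF half]
  by (metis poly_mapping_eqI lookup_add lookup_zero)

lemma mps_two_torsion_free: "(f :: ('n, 'a) mps) + f = 0 \<Longrightarrow> f = 0"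
  using half_two_torsion_free[OF half] by (metis mps_eqI coeff_add coeff_0)

sublocale poly: symmetric_quadratic_eval H "Const :: 'a \<Rightarrow> ('n, 'a) mpoly"
  by unfold_locales (rule mpoly_two_torsion_free)

sublocale formal: symmetric_quadratic_eval H "mps_const :: 'a \<Rightarrow> ('n, 'a) mps"
  by unfold_locales (rule mps_two_torsion_free)

lemma jacobian_mult: "jacobian H *v v = polar Const H Xmap v"
  using poly.eval_jacobian_mult[of Xmap v] by simp

sublocale flow: quadratic_flow "polar Const H" "deriv_along H" Xmap H
proof
  show "polar Const H Xmap Xmap = H + H"
    by (simp add: vec_eq_iff poly.polar_diag)
qed (erule poly.vec_two_torsion_free | rule polar_commute polar_add_left deriv_along_add
    deriv_along_polar deriv_along_Xmap poly.polar_nilpotent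
    jacobian_form_identity[unfolded jacobian_mult])+

lemma inverse_parts:
  obtains N1 N2 N3 N4 :: "('n, 'a) poly_map"
  where "\<And>i. homogeneous 2 (N1 $ i)" "\<And>i. homogeneous 3 (N2 $ i)"
    "\<And>i. homogeneous 4 (N3 $ i)" "\<And>i. homogeneous 5 (N4 $ i)"
    "poly_map_comp (Xmap - H) (Xmap + N1 + N2 + N3 + N4) = Xmap"
proof -
  define d where "d = (\<chi> i. Const h * polar Const H H H $ i)"
  have "(Const h :: ('n, 'a) mpoly) + Const h = 1"
    by (simp add: Const_add[symmetric] half)
  then have dd: "d + d = polar Const H H H"
    by (simp only: d_def vec_eq_iff vector_add_component vec_lambda_beta distrib_right[symmetric]
        mult_1_left simp_thms)
  \<comment> \<open>The summands of \<open>G\<close> in \<open>inverse_terminates\<close>, collected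
    by degree: weight \<open>m\<close> corresponds to degree \<open>m + 1\<close>, and
    \<open>H\<close> itself serves as the part of degree 2.\<close>
  define N2 where "N2 = polar Const H Xmap H"
  define N3 where "N3 = polar Const H Xmap N2 + d"
  define N4 where "N4 = polar Const H Xmap d"
  define G where "G = Xmap + H + N2 + N3 + N4"
  have N2: "homogeneous 3 (N2 $ i)" for i
    unfolding N2_def by (rule homogeneous_polar[OF homogeneous_Xmap quadratic]) simp
  have "homogeneous 4 (polar Const H H H $ i)" for i
    by (rule homogeneous_polar[OF quadratic quadratic]) simp
  then have d: "homogeneous 4 (d $ i)" for i
    using homogeneous_mult[OF homogeneous_Const] by (fastforce simp: d_def)
  have N3: "homogeneous 4 (N3 $ i)" for i
    unfolding N3_def vector_add_component
    by (intro homogeneous_add homogeneous_polar[OF homogeneous_Xmap N2] d) simp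
  have N4: "homogeneous 5 (N4 $ i)" for i
    unfolding N4_def by (rule homogeneous_polar[OF homogeneous_Xmap d]) simp
  have "(G - Xmap) + (G - Xmap) = polar Const H G G"
    using flow.inverse_terminates[OF dd] by (simp only: G_def N2_def N3_def N4_def)
  then have "(G $ i - Xmap $ i) + (G $ i - Xmap $ i)
      = peval Const (H $ i) G + peval Const (H $ i) G" for i
    by (metis poly.polar_diag vector_add_component vector_minus_component)
  \<comment> \<open>The equation so far is twice the desired \<open>G - H(G) = X\<close>.\<close>
  then have "(G $ i - peval Const (H $ i) G - Xmap $ i)
      + (G $ i - peval Const (H $ i) G - Xmap $ i) = 0" for i
    by (simp add: algebra_simps)
  then have "G $ i - peval Const (H $ i) G - Xmap $ i = 0" for i
    by (rule mpoly_two_torsion_free)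
  then have "poly_map_comp (Xmap - H) G = Xmap"
    by (simp add: poly_map_comp_def mpoly_subst_eq_peval Const.peval_diff vec_eq_iff Xmap_def)
  then show thesis
    using that[OF quadratic N2 N3 N4] by (simp add: G_def)
qed

lemma poly_map_comp_inj:
  assumes "poly_map_comp (Xmap - H) A = poly_map_comp (Xmap - H) B"
  shows "A = B"
proof (rule poly.quadratic_map_inj)
  fix i
  show "A $ i - peval Const (H $ i) A = B $ i - peval Const (H $ i) B"
    using arg_cong[OF assms, of "\<lambda>M. M $ i"]
    by (simp add: poly_map_comp_def mpoly_subst_eq_peval Const.peval_diff Xmap_def)
qed

lemma formal_map_comp_inj:
  assumes "mps_map_comp (formal_map (Xmap - H)) A = mps_map_comp (formal_map (Xmap - H)) B"
    and "\<And>i. coeff (A $ i) 0 = 0" "\<And>i. coeff (B $ i) 0 = 0"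
  shows "A = B"
proof (rule formal.quadratic_map_inj)
  fix i
  show "A $ i - peval mps_const (H $ i) A = B $ i - peval mps_const (H $ i) B"
    using arg_cong[OF assms(1), of "\<lambda>M. M $ i"]
    by (simp add: mps_map_comp_def formal_map_def mps_subst_mps_of_mpoly assms(2,3)
        mps_const.peval_diff Xmap_def)
qed

end

section \<open>Composition of polynomial maps and the final theorem\<close>

lemma poly_map_comp_assoc:
  "poly_map_comp (poly_map_comp F G) K = poly_map_comp F (poly_map_comp G K)"
  by (simp add: poly_map_comp_def mpoly_subst_eq_peval vec_eq_iff
      Const.peval_mpoly_subst[unfolded mpoly_subst_eq_peval])

lemma poly_map_comp_Xmap [simp]: "poly_map_comp F Xmap = F" "poly_map_comp Xmap F = F"
  by (simp_all add: poly_map_comp_def mpoly_subst_eq_peval vec_eq_iff)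
    (simp add: Xmap_def)

lemma rat_algebra_half:
  assumes "rat_algebra (qscale :: rat \<Rightarrow> 'a \<Rightarrow> 'a::comm_ring_1)"
  shows "\<exists>h::'a. h + h = 1"
proof -
  interpret vector_space qscale
    using assms by (simp add: rat_algebra_def)
  have "qscale (1/2) 1 + qscale (1/2) 1 = qscale (1/2 + 1/2) 1"
    by (rule scale_left_distrib[symmetric])
  then show ?thesis by auto
qed

theorem theorem3p9:
  fixes qscale :: "rat \<Rightarrow> 'a \<Rightarrow> 'a::comm_ring_1"
    and F H :: "('n::finite, 'a) poly_map"
  assumes "rat_algebra qscale"
    and "F = Xmap - H"
    and "transpose (jacobian F) = jacobian F"
    and "\<forall>i. homogeneous 2 (H $ i)"
    and "jacobian H ** jacobian H ** jacobian H ** jacobian H = 0"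
  shows "map_invertible F \<and>
    map_inverse F =
      Xmap + inverse_part F 1 + inverse_part F 2 + inverse_part F 3 + inverse_part F 4 \<and>
    map_degree (map_inverse F) \<le> 5"
proof -
  obtain h :: 'a where h: "h + h = 1"
    using rat_algebra_half[OF assms(1)] by blast
  \<comment> \<open>The Jacobians of \<open>H\<close> and \<open>F\<close> add up to the identity,
    so symmetry passes from \<open>F\<close> to \<open>H\<close>.\<close>
  have jacobian: "jacobian H $ i $ j = (if i = j then 1 else 0) - jacobian F $ i $ j" for i j
    by (simp add: assms(2) jacobian_def partial_deriv_diff Xmap_def partial_deriv_Var)
  interpret halved_symmetric_quadratic_map H h
  proof
    have "jacobian F $ i $ j = jacobian F $ j $ i" for i j
      using arg_cong[OF assms(3), of "\<lambda>M. M $ j $ i"] by (simp add: transpose_def)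
    then have "jacobian H $ i $ j = jacobian H $ j $ i" for i j
      unfolding jacobian by auto
    then show "transpose (jacobian H) = jacobian H"
      by (simp add: transpose_def vec_eq_iff)
  qed (use assms h in auto)
  obtain N1 N2 N3 N4 :: "('n, 'a) poly_map"
    where N: "\<And>i. homogeneous 2 (N1 $ i)" "\<And>i. homogeneous 3 (N2 $ i)"
      "\<And>i. homogeneous 4 (N3 $ i)" "\<And>i. homogeneous 5 (N4 $ i)"
      and right: "poly_map_comp F (Xmap + N1 + N2 + N3 + N4) = Xmap"
    using inverse_parts unfolding assms(2) by blast
  define G where "G = Xmap + N1 + N2 + N3 + N4"
  have right: "poly_map_comp F G = Xmap"
    using right by (simp add: G_def)
  \<comment> \<open>By associativity \<open>F\<close> after \<open>G\<close> after \<open>F\<close>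
    equals \<open>F\<close>, and injectivity cancels the outer \<open>F\<close>.\<close>
  have left: "poly_map_comp G F = Xmap"
    by (rule poly_map_comp_inj)
      (simp add: right poly_map_comp_assoc[symmetric] flip: assms(2))
  have inverse: "is_poly_inverse F G"
    using left right by (simp add: is_poly_inverse_def)
  have map_inverse: "map_inverse F = G"
    unfolding map_inverse_def
  proof (rule the_equality, rule inverse)
    fix G' assume "is_poly_inverse F G'"
    then have "poly_map_comp F G' = poly_map_comp F G"
      using right by (simp add: is_poly_inverse_def)
    then show "G' = G"
      unfolding assms(2) by (rule poly_map_comp_inj)
  qed
  \<comment> \<open>The summands of \<open>G\<close> have distinct degrees, so at most one of them
    contributes to each exponent.\<close>
  have lookup_G: "Poly_Mapping.lookup (G $ i) e =
      (if mdeg e = 1 then Poly_Mapping.lookup (Xmap $ i) e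
       else if mdeg e = 2 then Poly_Mapping.lookup (N1 $ i) e
       else if mdeg e = 3 then Poly_Mapping.lookup (N2 $ i) e
       else if mdeg e = 4 then Poly_Mapping.lookup (N3 $ i) e
       else if mdeg e = 5 then Poly_Mapping.lookup (N4 $ i) e else 0)" for i e
    by (simp add: G_def lookup_add homogeneous_lookup[OF N(1)] homogeneous_lookup[OF N(2)]
        homogeneous_lookup[OF N(3)] homogeneous_lookup[OF N(4)] homogeneous_lookup[OF homogeneous_Xmap])
  have F_0: "Poly_Mapping.lookup (F $ i) 0 = 0" for i
    by (simp add: assms(2) lookup_minus homogeneous_lookup[OF homogeneous_Xmap]
        homogeneous_lookup[OF quadratic])
  have G_0: "Poly_Mapping.lookup (G $ i) 0 = 0" for i
    by (simp add: lookup_G)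
  have formal: "is_formal_inverse F (formal_map G)"
    unfolding is_formal_inverse_def mps_map_comp_formal_map[OF F_0] mps_map_comp_formal_map[OF G_0]
  proof (intro conjI allI impI)
    fix i and e :: "'n monom" assume "mdeg e \<le> 1"
    then show "coeff (formal_map G $ i) e = Poly_Mapping.lookup (Var i) e"
      using homogeneous_lookup[OF homogeneous_Xmap, of e i]
      by (cases "mdeg e = 1") (simp_all add: formal_map_def lookup_G Xmap_def)
  qed (simp_all add: left right)
  have formal_inverse: "formal_inverse F = formal_map G"
    unfolding formal_inverse_def
  proof (rule the_equality, rule formal)
    fix G' assume G': "is_formal_inverse F G'"
    \<comment> \<open>\<open>formal_map_comp_inj\<close> asks for points without constant term; the
      normalization in \<open>is_formal_inverse\<close>, read at \<open>e = 0\<close>, supplies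
      this.\<close>
    have zero: "coeff (K $ i) 0 = 0" if "is_formal_inverse F K" for K i
      using that homogeneous_lookup[OF homogeneous_Xmap, of 0 i] by (simp add: is_formal_inverse_def Xmap_def)
    show "G' = formal_map G"
    proof (rule formal_map_comp_inj[OF _ zero[OF G'] zero[OF formal]])
      show "mps_map_comp (formal_map (Xmap - H)) G' = mps_map_comp (formal_map (Xmap - H)) (formal_map G)"
        using G' formal by (simp add: is_formal_inverse_def assms(2))
    qed
  qed
  have lookup_part: "Poly_Mapping.lookup (inverse_part F m $ i) e =
      (if mdeg e = m + 1 then Poly_Mapping.lookup (G $ i) e else 0)" for m i e
    by (simp add: inverse_part_def formal_inverse lookup_hom_component formal_map_def)
  have "inverse_part F 1 = N1" "inverse_part F 2 = N2" "inverse_part F 3 = N3" "inverse_part F 4 = N4"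
    by (auto simp: vec_eq_iff lookup_part lookup_G homogeneous_lookup[OF N(1)]
        homogeneous_lookup[OF N(2)] homogeneous_lookup[OF N(3)] homogeneous_lookup[OF N(4)]
        intro!: poly_mapping_eqI)
  moreover have "total_degree (G $ i) \<le> 5" for i
  proof -
    have "mdeg e \<le> 5" if "e \<in> Poly_Mapping.keys (G $ i)" for e
      using that by (auto simp: in_keys_iff lookup_G split: if_splits)
    then show ?thesis
      by (simp add: total_degree_def)
  qed
  then have "map_degree G \<le> 5"
    by (simp add: map_degree_def)
  ultimately show ?thesis
    using inverse by (auto simp: map_invertible_def map_inverse G_def)
qed

end
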